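(* Let $\mathbf{x}_1,\ldots,\mathbf{x}_m\in\mathbb{R}^p$ be pairwise distinct vectors, let $1\le t<m$, and let $k\in\{1,\ldots,m\}\setminus\{1,\ldots,t\}$. Let $z^*$ be the optimal value of the following linear program in the variables $\mathbf{d}\in\mathbb{R}^p$, $s_1,\ldots,s_{t+p}\in\mathbb{R}$, $r_1,\ldots,r_{t+p}\in\mathbb{R}$: $$\begin{array}{lll}\min & \sum_{j=1}^{t+p} r_j & \\ \text{s.t.} & (\mathbf{x}_j-\mathbf{x}_k)^T\mathbf{d}-s_j+r_j=1, & j=1,\ldots,t,\\ & d_i-s_{t+i}+r_{t+i}=1, & i=1,\ldots,p,\\ & s_j,r_j\geq 0, & j=1,\ldots,t+p,\\ & \mathbf{d}\geq \mathbf{0}. & \end{array}$$ Then there exists an increasing quasi-concave function $\vartheta:\mathbb{R}^p\to\mathbb{R}$ satisfying $\vartheta(\mathbf{x}_j)>\vartheta(\mathbf{x}_k)$ for all $j=1,2,\ldots,t$ if and only if $z^*=0$. Moreover, if $z^*=0$, such a function can be defined as follows: there exists $\bar\epsilon>0$ such that the cone $E^{\bar\epsilon}$ is pointed, and for any such $\bar\epsilon$ the function $$\vartheta(\mathbf{x}):=\mathrm{dist}(\mathbf{x}-\mathbf{x}_k;\mathbb{R}^p\setminus E^{\bar\epsilon})-\mathrm{dist}(\mathbf{x}-\mathbf{x}_k;E^{\bar\epsilon}),\qquad \mathbf{x}\in\mathbb{R}^p,$$ is increasing, quasi-concave, and satisfies $\vartheta(\mathbf{x}_j)>\vartheta(\mathbf{x}_k)$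 for all $j=1,\ldots,t$.
   Context: Vector inequalities are understood componentwise; $\mathbb{R}^p_+=\{\mathbf{x}\in\mathbb{R}^p:\mathbf{x}\ge\mathbf{0}\}$; $\mathbf{e}\in\mathbb{R}^p$ is the vector all of whose components equal one. For $\epsilon>0$, $$E^{\epsilon}:=\Big\{\sum_{j=1}^{t}\lambda_j(\mathbf{x}_j-\epsilon\mathbf{e}-\mathbf{x}_k):\ \lambda_1,\ldots,\lambda_t\ge 0\Big\}+\mathbb{R}^p_+ .$$ A convex cone $C$ is pointed if $C\cap(-C)=\{\mathbf{0}\}$. For nonempty $\Omega\subset\mathbb{R}^p$, $\mathrm{dist}(\mathbf{x};\Omega):=\inf_{\omega\in\Omega}\|\mathbf{x}-\omega\|$ with the Euclidean norm. A function $f:\mathbb{R}^p\to\mathbb{R}$ is quasi-concave if $f(\lambda\mathbf{x}+(1-\lambda)\mathbf{y})\ge\min\{f(\mathbf{x}),f(\mathbf{y})\}$ for all $\mathbf{x},\mathbf{y}\in\mathbb{R}^p$ and $\lambda\in[0,1]$. It is increasing if $\mathbf{x}\le\mathbf{y}$ implies $f(\mathbf{x})\le f(\mathbf{y})$. *)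

theory Defs
  imports "HOL-Analysis.Analysis"
begin

definition quasi_concave :: "('a::real_vector \<Rightarrow> real) \<Rightarrow> bool"
  where "quasi_concave f \<longleftrightarrow>
    (\<forall>x y. \<forall>u\<in>{0..1}. min (f x) (f y) \<le> f (u *\<^sub>R x + (1 - u) *\<^sub>R y))"

text \<open>Meant for convex cones. The minus sign on sets denotes the complement, so the
  reflected cone has to be written as an image.\<close>

definition pointed :: "'a::real_vector set \<Rightarrow> bool"
  where "pointed C \<longleftrightarrow> C \<inter> uminus ` C = {0}"

text \<open>In the two definitions below, the order on \<^typ>\<open>real ^ 'p\<close> is the componentwise one
  and \<^term>\<open>1 :: real ^ 'p\<close> is the all-ones vector.\<close>

definition E_cone :: "(nat \<Rightarrow> real ^ 'p) \<Rightarrow> nat \<Rightarrow> nat \<Rightarrow> real \<Rightarrow> (real ^ 'p) set"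
  where "E_cone x t k \<epsilon> =
    {(\<Sum>j\<in>{1..t}. c j *\<^sub>R (x j - \<epsilon> *\<^sub>R 1 - x k)) + v | c v.
      (\<forall>j\<in>{1..t}. 0 \<le> c j) \<and> 0 \<le> v}"

text \<open>The indices \<open>1, \<dots>, t + p\<close> of the slack variables \<open>s\<close> and \<open>r\<close> are modelled by the
  disjoint sum of \<open>{1..t}\<close> and the coordinate type: \<open>Inl j\<close> is the index \<open>j \<le> t\<close>, and
  \<open>Inr i\<close> is the index \<open>t + i\<close>. Values of \<open>s\<close> and \<open>r\<close> off this index set are unconstrained
  and do not enter the objective.\<close>

definition lp_feasible :: "(nat \<Rightarrow> real ^ 'p) \<Rightarrow> nat \<Rightarrow> nat \<Rightarrow>
    real ^ 'p \<Rightarrow> (nat + 'p \<Rightarrow> real) \<Rightarrow> (nat + 'p \<Rightarrow> real) \<Rightarrow> bool"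
  where "lp_feasible x t k d s r \<longleftrightarrow>
    (\<forall>j\<in>{1..t}. (x j - x k) \<bullet> d - s (Inl j) + r (Inl j) = 1) \<and>
    (\<forall>i. d $ i - s (Inr i) + r (Inr i) = 1) \<and>
    (\<forall>l\<in>{1..t} <+> UNIV. 0 \<le> s l \<and> 0 \<le> r l) \<and>
    0 \<le> d"

definition lp_objective :: "nat \<Rightarrow> (nat + 'p::finite \<Rightarrow> real) \<Rightarrow> real"
  where "lp_objective t r = (\<Sum>l\<in>{1..t} <+> UNIV. r l)"

definition lp_value :: "(nat \<Rightarrow> real ^ 'p) \<Rightarrow> nat \<Rightarrow> nat \<Rightarrow> real"
  where "lp_value x t k = Inf {lp_objective t r | d s r. lp_feasible x t k d s r}"

definition signed_dist :: "(real ^ 'p) set \<Rightarrow> real ^ 'p \<Rightarrow> real"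
  where "signed_dist C y = infdist y (UNIV - C) - infdist y C"

lemma convex_cone_E_cone: "convex_cone (E_cone x t k \<epsilon>)"
  unfolding convex_cone_iff
proof (intro conjI ballI allI impI)
  let ?a = "\<lambda>j. x j - \<epsilon> *\<^sub>R 1 - x k"
  show "0 \<in> E_cone x t k \<epsilon>"
    unfolding E_cone_def by (rule CollectI, rule exI[of _ "\<lambda>_. 0"], rule exI[of _ 0]) simp
  fix u assume "u \<in> E_cone x t k \<epsilon>"
  then obtain l v where u: "u = (\<Sum>j\<in>{1..t}. l j *\<^sub>R ?a j) + v" "\<forall>j\<in>{1..t}. 0 \<le> l j" "0 \<le> v"
    unfolding E_cone_def by blast
  {
    fix w assume "w \<in> E_cone x t k \<epsilon>"
    then obtain l' v' where w: "w = (\<Sum>j\<in>{1..t}. l' j *\<^sub>R ?a j) + v'"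
        "\<forall>j\<in>{1..t}. 0 \<le> l' j" "0 \<le> v'"
      unfolding E_cone_def by blast
    have "u + w = (\<Sum>j\<in>{1..t}. (l j + l' j) *\<^sub>R ?a j) + (v + v')"
      unfolding u(1) w(1) scaleR_add_left sum.distrib by (simp add: algebra_simps)
    moreover have "\<forall>j\<in>{1..t}. 0 \<le> l j + l' j" "0 \<le> v + v'"
      using u w by (simp_all add: less_eq_vec_def)
    ultimately show "u + w \<in> E_cone x t k \<epsilon>"
      unfolding E_cone_def
      by (intro CollectI exI[of _ "\<lambda>j. l j + l' j"] exI[of _ "v + v'"] conjI)
  }
  fix c :: real assume c: "0 \<le> c"
  have "c *\<^sub>R u = (\<Sum>j\<in>{1..t}. (c * l j) *\<^sub>R ?a j) + c *\<^sub>R v"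
    unfolding u(1) scaleR_add_right scaleR_sum_right scaleR_scaleR by (rule refl)
  moreover have "\<forall>j\<in>{1..t}. 0 \<le> c * l j" "0 \<le> c *\<^sub>R v"
    using u c by (simp_all add: less_eq_vec_def)
  ultimately show "c *\<^sub>R u \<in> E_cone x t k \<epsilon>"
    unfolding E_cone_def
    by (intro CollectI exI[of _ "\<lambda>j. c * l j"] exI[of _ "c *\<^sub>R v"] conjI)
qed

text \<open>The infimum in \<^const>\<open>lp_value\<close> is over a nonempty set that is bounded below.\<close>

lemma lp_feasible_trivial: "lp_feasible x t k 0 (\<lambda>_. 0) (\<lambda>_. 1)"
  by (simp add: lp_feasible_def)

lemma lp_objective_nonneg: "lp_feasible x t k d s r \<Longrightarrow> 0 \<le> lp_objective t r"
  unfolding lp_feasible_def lp_objective_def by (intro sum_nonneg) blast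

end

theory Submission
  imports Defs
begin

text \<open>Both the linear program and the existence of \<open>\<theta>\<close> are equivalent to the existence of a
  strictly positive \<open>d\<close> with \<open>(x\<^sub>j - x\<^sub>k) \<bullet> d > 0\<close> for all \<open>j \<le> t\<close>. A function \<open>\<theta>\<close> keeps \<open>x\<^sub>k\<close> out
  of the closed convex set \<open>conv {x\<^sub>1, \<dots>, x\<^sub>t} + \<real>\<^sup>p\<^sub>+\<close>; the separating functional is nonnegative and
  becomes positive after a small perturbation. Conversely, for small \<open>\<epsilon>\<close> such a \<open>d\<close> is positive on
  \<open>E\<^sup>\<epsilon> - {0}\<close>, so that \<open>E\<^sup>\<epsilon>\<close> is pointed. The signed distance to a convex set is quasi-concave; it
  vanishes at the vertex of a pointed cone, and it is positive at \<open>x\<^sub>j - x\<^sub>k\<close> because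
  \<open>x\<^sub>j - x\<^sub>k - \<epsilon> e \<in> E\<^sup>\<epsilon>\<close> puts a ball of radius \<open>\<epsilon>\<close> around \<open>x\<^sub>j - x\<^sub>k\<close> into \<open>E\<^sup>\<epsilon>\<close>.\<close>

text \<open>As \<eta> tends to 0 from the right, each \<open>\<eta> * g j\<close> tends to 0, and
  finitely many such conditions hold simultaneously. This supplies the perturbation of
  \<open>d\<close>, the scaling of the linear program and the choice of \<epsilon>.\<close>

lemma finite_small_multiple:
  fixes f g :: "'a \<Rightarrow> real"
  assumes "finite J" and "\<And>j. j \<in> J \<Longrightarrow> 0 < f j"
  shows "\<exists>\<eta>>0. \<forall>j\<in>J. \<eta> * g j < f j"
proof -
  have "eventually (\<lambda>\<eta>. \<eta> * g j < f j) (at_right 0)" if "j \<in> J" for j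
  proof (rule order_tendstoD(2))
    show "((\<lambda>\<eta>. \<eta> * g j) \<longlongrightarrow> 0) (at_right 0)"
      by (auto intro!: tendsto_eq_intros)
  qed (simp add: assms(2) that)
  then have "eventually (\<lambda>\<eta>. \<forall>j\<in>J. \<eta> * g j < f j) (at_right 0)"
    by (simp add: assms(1) eventually_ball_finite)
  then have "eventually (\<lambda>\<eta>. 0 < \<eta> \<and> (\<forall>j\<in>J. \<eta> * g j < f j)) (at_right 0)"
    using eventually_at_right_less by eventually_elim auto
  then show ?thesis
    using eventually_happens trivial_limit_at_right_real by blast
qed

subsection \<open>Positive functionals\<close>

lemma inner_nonneg_vec:
  fixes d v :: "real ^ 'p"
  assumes "0 \<le> d" and "0 \<le> v"
  shows "0 \<le> v \<bullet> d"
  using assms by (auto simp: inner_vec_def less_eq_vec_def intro!: sum_nonneg)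

lemma inner_eq_0_pos_vec:
  fixes d v :: "real ^ 'p"
  assumes "\<And>i. 0 < d $ i" and "0 \<le> v" and "v \<bullet> d = 0"
  shows "v = 0"
proof -
  have "\<forall>i\<in>UNIV. v $ i \<bullet> d $ i = 0"
    using assms unfolding inner_vec_def
    by (subst (asm) sum_nonneg_eq_0_iff) (auto simp: less_eq_vec_def less_imp_le)
  then show ?thesis
    using assms(1) by (metis UNIV_I inner_real_def less_irrefl mult_eq_0_iff vec_eq_iff zero_index)
qed

text \<open>Adding a small multiple of the all-ones vector makes every coordinate positive, and the
  finitely many strict inequalities survive.\<close>

lemma positive_functional_perturbation:
  fixes a :: "'a \<Rightarrow> real ^ 'p"
  assumes "finite J" and "0 \<le> d" and "\<And>j. j \<in> J \<Longrightarrow> 0 < a j \<bullet> d"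
  shows "\<exists>d'. (\<forall>i. 0 < d' $ i) \<and> (\<forall>j\<in>J. 0 < a j \<bullet> d')"
proof -
  obtain \<eta> where \<eta>: "0 < \<eta>" "\<forall>j\<in>J. \<eta> * (- (a j \<bullet> 1)) < a j \<bullet> d"
    using finite_small_multiple[of J "\<lambda>j. a j \<bullet> d" "\<lambda>j. - (a j \<bullet> 1)"] assms by blast
  have "0 < (d + \<eta> *\<^sub>R 1) $ i" for i
    using assms(2) \<eta>(1) by (simp add: less_eq_vec_def add_nonneg_pos)
  moreover have "\<forall>j\<in>J. 0 < a j \<bullet> (d + \<eta> *\<^sub>R 1)"
    using \<eta>(2) by (auto simp: inner_add_right)
  ultimately show ?thesis by blast
qed

section \<open>The linear program\<close>

text \<open>Forward, one feasible point with objective below 1 suffices: every \<open>r l\<close> is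
  below 1, so its constraint forces a positive quantity. Backward, a large multiple of
  \<open>d\<close> satisfies all constraints with \<open>r\<close> zero.\<close>

lemma lp_value_eq_0_iff:
  fixes x :: "nat \<Rightarrow> real ^ 'p"
  shows "lp_value x t k = 0 \<longleftrightarrow> (\<exists>d. (\<forall>i. 0 < d $ i) \<and> (\<forall>j\<in>{1..t}. 0 < (x j - x k) \<bullet> d))"
proof
  let ?V = "{lp_objective t r | d s r. lp_feasible x t k d s r}"
  have bdd: "bdd_below ?V"
    by (rule bdd_belowI[of _ 0]) (auto intro: lp_objective_nonneg)
  {
    assume "lp_value x t k = 0"
    moreover have "?V \<noteq> {}"
      using lp_feasible_trivial by blast
    ultimately have "\<exists>v\<in>?V. v < 1"
      using cInf_lessD[of ?V 1] unfolding lp_value_def by simp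
    then obtain d s r where f: "lp_feasible x t k d s r" and "lp_objective t r < 1"
      by blast
    have lt: "r l < 1" if "l \<in> {1..t} <+> UNIV" for l
    proof -
      have "r l \<le> lp_objective t r"
        unfolding lp_objective_def
        using f that by (intro member_le_sum) (auto simp: lp_feasible_def)
      with \<open>lp_objective t r < 1\<close> show ?thesis by simp
    qed
    have "0 < d $ i" for i
    proof -
      have "d $ i - s (Inr i) + r (Inr i) = 1" "0 \<le> s (Inr i)" "r (Inr i) < 1"
        using f lt[of "Inr i"] by (auto simp: lp_feasible_def)
      then show ?thesis by linarith
    qed
    moreover have "0 < (x j - x k) \<bullet> d" if "j \<in> {1..t}" for j
    proof -
      have "(x j - x k) \<bullet> d - s (Inl j) + r (Inl j) = 1" "0 \<le> s (Inl j)" "r (Inl j) < 1"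
        using f lt[of "Inl j"] that unfolding lp_feasible_def by blast+
      then show ?thesis by linarith
    qed
    ultimately show "\<exists>d. (\<forall>i. 0 < d $ i) \<and> (\<forall>j\<in>{1..t}. 0 < (x j - x k) \<bullet> d)"
      by blast
  }
  assume "\<exists>d. (\<forall>i. 0 < d $ i) \<and> (\<forall>j\<in>{1..t}. 0 < (x j - x k) \<bullet> d)"
  then obtain d where d: "\<And>i. 0 < d $ i" "\<And>j. j \<in> {1..t} \<Longrightarrow> 0 < (x j - x k) \<bullet> d"
    by blast
  define g where "g = (\<lambda>l. case l of Inl j \<Rightarrow> (x j - x k) \<bullet> d | Inr i \<Rightarrow> d $ i)"
  have g_pos: "0 < g l" if "l \<in> {1..t} <+> UNIV" for l
    using that d by (auto simp: g_def)
  obtain \<eta> where \<eta>: "0 < \<eta>" "\<forall>l\<in>{1..t} <+> UNIV. \<eta> * 1 < g l"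
    using finite_small_multiple[of "{1..t} <+> UNIV" g "\<lambda>_. 1"] g_pos by auto
  \<comment> \<open>Since \<eta> lies below every \<open>g l\<close>, the rescaled quantities exceed
    1, and \<open>s\<close> absorbs the surplus.\<close>
  have "lp_feasible x t k (d /\<^sub>R \<eta>) (\<lambda>l. g l / \<eta> - 1) (\<lambda>_. 0)"
    unfolding lp_feasible_def
  proof (intro conjI ballI allI)
    fix l :: "nat + 'p"
    assume "l \<in> {1..t} <+> UNIV"
    then have "\<eta> < g l" using \<eta>(2) by simp
    then show "0 \<le> g l / \<eta> - 1" using \<eta>(1) by simp
  next
    show "0 \<le> d /\<^sub>R \<eta>"
      using d(1) \<eta>(1) by (simp add: less_eq_vec_def less_imp_le)
  qed (simp_all add: g_def divide_inverse_commute)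
  then have "lp_objective t (\<lambda>_ :: nat + 'p. 0) \<in> ?V"
    by blast
  then have "lp_value x t k \<le> lp_objective t (\<lambda>_ :: nat + 'p. 0)"
    unfolding lp_value_def by (rule cInf_lower[OF _ bdd])
  moreover have "0 \<le> lp_value x t k"
    unfolding lp_value_def
  proof (rule cInf_greatest)
    show "?V \<noteq> {}"
      using lp_feasible_trivial by blast
  qed (auto intro: lp_objective_nonneg)
  ultimately show "lp_value x t k = 0"
    by (simp add: lp_objective_def)
qed

subsection \<open>From an increasing quasi-concave function to a positive functional\<close>

lemma convex_quasi_concave_superlevel:
  assumes "quasi_concave f"
  shows "convex {y. c < f y}"
  unfolding convex_alt
proof (intro ballI allI impI)
  fix y z and u :: real
  assume "y \<in> {y. c < f y}" "z \<in> {y. c < f y}" "0 \<le> u \<and> u \<le> 1"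
  then show "(1 - u) *\<^sub>R y + u *\<^sub>R z \<in> {y. c < f y}"
    using assms[unfolded quasi_concave_def, rule_format, of u z y]
    by (simp add: add.commute)
qed

text \<open>The set \<open>T\<close> is closed as the sum of a compact and a closed set.
  Quasi-concavity gives values above \<open>f z\<close> on the hull, monotonicity extends this to
  \<open>T\<close>, and so \<open>z\<close> can be strictly separated from \<open>T\<close>.\<close>

lemma positive_functional_of_quasi_concave:
  fixes f :: "real ^ 'p \<Rightarrow> real"
  assumes "finite S" and "S \<noteq> {}" and "mono f" and "quasi_concave f"
    and gt: "\<And>y. y \<in> S \<Longrightarrow> f z < f y"
  shows "\<exists>d\<ge>0. \<forall>y\<in>S. 0 < (y - z) \<bullet> d"
proof -
  define T where "T = (\<Union>u\<in>convex hull S. \<Union>v\<in>{v. 0 \<le> v}. {u + v})"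
  have orthant: "{v :: real ^ 'p. 0 \<le> v} = (\<Inter>i. {v. 0 \<le> v $ i})"
    by (auto simp: less_eq_vec_def)
  have "closed {v :: real ^ 'p. 0 \<le> v}"
    unfolding orthant by (intro closed_INT ballI closed_Collect_le continuous_intros)
  then have "closed T"
    unfolding T_def
    by (intro compact_closed_sums finite_imp_compact_convex_hull assms(1))
  have "convex {v :: real ^ 'p. 0 \<le> v}"
    by (auto simp: convex_def less_eq_vec_def)
  then have "convex T"
    unfolding T_def by (intro convex_sums convex_convex_hull)
  have "f z < f w" if w_in: "w \<in> T" for w
  proof -
    obtain u v where w: "w = u + v" "u \<in> convex hull S" "0 \<le> v"
      using w_in unfolding T_def by blast
    have "convex hull S \<subseteq> {y. f z < f y}"
      using gt by (intro hull_minimal convex_quasi_concave_superlevel assms) auto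
    moreover have "f u \<le> f w"
      using w by (intro monoD[OF \<open>mono f\<close>]) (simp add: less_eq_vec_def)
    ultimately show ?thesis
      using w by (auto intro: less_le_trans)
  qed
  then have "z \<notin> T" by blast
  then obtain d b where d: "d \<bullet> z < b" "\<And>w. w \<in> T \<Longrightarrow> b < d \<bullet> w"
    using separating_hyperplane_closed_point[OF \<open>convex T\<close> \<open>closed T\<close>] by blast
  have T: "y + v \<in> T" if "y \<in> S" "0 \<le> v" for y v
    using that hull_inc[of y S] unfolding T_def by blast
  obtain y where "y \<in> S" using assms(2) by blast
  have "0 \<le> d $ i" for i
  proof (rule ccontr)
    assume "\<not> 0 \<le> d $ i"
    \<comment> \<open>Moving from \<open>y\<close> by \<open>c\<close> along axis \<open>i\<close>
      stays in \<open>T\<close> but lowers the functional to exactly \<open>b\<close>, against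
      strict separation.\<close>
    define c where "c = (b - d \<bullet> y) / d $ i"
    have "d \<bullet> y > b"
      using d(2) T[OF \<open>y \<in> S\<close>, of 0] by simp
    then have "0 \<le> c"
      using \<open>\<not> 0 \<le> d $ i\<close> by (simp add: c_def divide_nonpos_neg)
    then have "y + axis i c \<in> T"
      by (intro T \<open>y \<in> S\<close>) (simp add: less_eq_vec_def axis_def)
    then have "b < d \<bullet> y + d $ i * c"
      using d(2) by (fastforce simp: inner_add_right inner_axis)
    then show False
      using \<open>\<not> 0 \<le> d $ i\<close> by (simp add: c_def)
  qed
  moreover have "0 < (y - z) \<bullet> d" if "y \<in> S" for y
    using d(1) d(2)[of y] T[OF that, of 0] by (simp add: inner_diff_right inner_commute[of _ d])
  ultimately show ?thesis
    by (metis less_eq_vec_def zero_index)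
qed

subsection \<open>The signed distance\<close>

text \<open>Strictness matters: the infimum need not be attained when \<open>A\<close> is not
  closed.\<close>

lemma infdist_less_iff:
  assumes "A \<noteq> {}"
  shows "infdist x A < r \<longleftrightarrow> (\<exists>a\<in>A. dist x a < r)"
  using assms by (subst infdist_notempty) (auto simp: cINF_less_iff)

text \<open>A strict sublevel set is the Minkowski sum of \<open>C\<close> and an open ball, hence
  convex; the non-strict one is an intersection of these.\<close>

lemma convex_infdist_sublevel:
  fixes C :: "'a::real_normed_vector set"
  assumes "convex C" and "C \<noteq> {}"
  shows "convex {y. infdist y C \<le> r}"
proof -
  have "convex {y. infdist y C < s}" for s
  proof -
    have "{y. infdist y C < s} = (\<Union>a\<in>C. \<Union>b\<in>ball 0 s. {a + b})"
    proof safe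
      fix y assume "infdist y C < s"
      then obtain a where "a \<in> C" "dist y a < s"
        using infdist_less_iff[OF assms(2)] by blast
      moreover from this have "y = a + (y - a)" "y - a \<in> ball 0 s"
        by (auto simp: dist_norm norm_minus_commute)
      ultimately show "y \<in> (\<Union>a\<in>C. \<Union>b\<in>ball 0 s. {a + b})"
        by blast
    next
      fix a b :: 'a assume "a \<in> C" "b \<in> ball 0 s"
      then show "infdist (a + b) C < s"
        using infdist_less_iff[OF assms(2)] by (force simp: dist_norm)
    qed
    then show ?thesis
      using convex_sums[OF assms(1) convex_ball[of 0 s]] by simp
  qed
  moreover have "{y. infdist y C \<le> r} = (\<Inter>s\<in>{r<..}. {y. infdist y C < s})"
    by (auto intro: dense_ge)
  ultimately show ?thesis
    by (auto intro: convex_INT)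
qed

text \<open>Both sides say that the open ball misses the complement. Properness of \<open>C\<close>
  rules out the default value 0 of \<open>infdist\<close> for the empty set.\<close>

lemma le_infdist_compl_iff:
  assumes "C \<noteq> UNIV"
  shows "r \<le> infdist y (UNIV - C) \<longleftrightarrow> ball y r \<subseteq> C"
proof -
  have "UNIV - C \<noteq> {}" using assms by blast
  then show ?thesis
    using infdist_less_iff[of "UNIV - C" y r] by (auto simp: not_less[symmetric] subset_iff)
qed

lemma signed_dist_mem: "y \<in> C \<Longrightarrow> signed_dist C y = infdist y (UNIV - C)"
  by (simp add: signed_dist_def)

lemma signed_dist_not_mem: "y \<notin> C \<Longrightarrow> signed_dist C y = - infdist y C"
  by (simp add: signed_dist_def)

text \<open>Superlevel sets are convex: for \<alpha> > 0 they consist of the centres of open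
  \<alpha>-balls inside \<open>C\<close>, otherwise they are sublevel sets of
  \<open>infdist\<close>.\<close>

lemma quasi_concave_signed_dist:
  fixes C :: "(real ^ 'p) set"
  assumes "convex C" and "C \<noteq> {}" and "C \<noteq> UNIV"
  shows "quasi_concave (signed_dist C)"
  unfolding quasi_concave_def
proof (intro allI ballI)
  fix y z :: "real ^ 'p" and u :: real
  assume u: "u \<in> {0..1}"
  define w where "w = u *\<^sub>R y + (1 - u) *\<^sub>R z"
  define \<alpha> where "\<alpha> = min (signed_dist C y) (signed_dist C z)"
  show "\<alpha> \<le> signed_dist C w"
  proof (cases "0 < \<alpha>")
    case True
    have ball: "ball q \<alpha> \<subseteq> C" if "\<alpha> \<le> signed_dist C q" for q
    proof -
      have "q \<in> C"
        using that True signed_dist_not_mem[of q C] infdist_nonneg[of q C] by force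
      then show ?thesis
        using that le_infdist_compl_iff[OF assms(3)] by (simp add: signed_dist_mem)
    qed
    have "ball w \<alpha> \<subseteq> C"
    proof
      fix v assume "v \<in> ball w \<alpha>"
      then have "norm (w - v) < \<alpha>" by (simp add: dist_norm)
      \<comment> \<open>Translating \<open>y\<close> and \<open>z\<close> by the same vector
        \<open>v - w\<close> makes \<open>v\<close> the corresponding convex combination of two
        points of \<open>C\<close>.\<close>
      then have "y + (v - w) \<in> C" "z + (v - w) \<in> C"
        using ball[of y] ball[of z]
        by (auto simp: \<alpha>_def dist_norm subset_iff norm_minus_commute)
      then have "u *\<^sub>R (y + (v - w)) + (1 - u) *\<^sub>R (z + (v - w)) \<in> C"
        using u by (intro convexD[OF assms(1)]) auto
      then show "v \<in> C"
        by (simp add: w_def algebra_simps)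
    qed
    moreover from this have "w \<in> C" using True by force
    ultimately show ?thesis
      using le_infdist_compl_iff[OF assms(3)] by (simp add: signed_dist_mem)
  next
    case False
    have level: "\<alpha> \<le> signed_dist C q \<longleftrightarrow> infdist q C \<le> - \<alpha>" for q
      using False infdist_nonneg[of q "UNIV - C"]
      by (cases "q \<in> C") (auto simp: signed_dist_mem signed_dist_not_mem)
    have "y \<in> {q. infdist q C \<le> - \<alpha>}" "z \<in> {q. infdist q C \<le> - \<alpha>}"
      using level[of y] level[of z] by (auto simp: \<alpha>_def)
    then have "w \<in> {q. infdist q C \<le> - \<alpha>}"
      unfolding w_def using u
      by (intro convexD[OF convex_infdist_sublevel[OF assms(1,2)]]) auto
    then show ?thesis by (simp add: level)
  qed
qed

text \<open>Translation by \<open>z - y\<close> maps \<open>C\<close> into itself, and the reverse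
  translation maps the complement into itself; both preserve distances to the shifted
  points.\<close>

lemma mono_signed_dist:
  fixes C :: "(real ^ 'p) set"
  assumes up: "\<And>y v. y \<in> C \<Longrightarrow> 0 \<le> v \<Longrightarrow> y + v \<in> C" and "C \<noteq> {}" and "C \<noteq> UNIV"
  shows "mono (signed_dist C)"
proof (rule monoI)
  fix y z :: "real ^ 'p"
  assume "y \<le> z"
  then have v: "0 \<le> z - y" by (simp add: less_eq_vec_def)
  have "infdist z C \<le> infdist y C"
    unfolding infdist_notempty[OF \<open>C \<noteq> {}\<close>, of y]
  proof (rule cINF_greatest[OF \<open>C \<noteq> {}\<close>])
    fix a assume "a \<in> C"
    then show "infdist z C \<le> dist y a"
      using up[OF _ v] by (intro infdist_le2[of "a + (z - y)"]) (auto simp: dist_norm)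
  qed
  moreover have "UNIV - C \<noteq> {}" using \<open>C \<noteq> UNIV\<close> by blast
  have "infdist y (UNIV - C) \<le> infdist z (UNIV - C)"
    unfolding infdist_notempty[OF \<open>UNIV - C \<noteq> {}\<close>, of z]
  proof (rule cINF_greatest[OF \<open>UNIV - C \<noteq> {}\<close>])
    fix a assume "a \<in> UNIV - C"
    then have "a - (z - y) \<in> UNIV - C"
      using up[OF _ v, of "a - (z - y)"] by auto
    then show "infdist y (UNIV - C) \<le> dist z a"
      by (rule infdist_le2) (simp add: dist_norm)
  qed
  ultimately show "signed_dist C y \<le> signed_dist C z"
    by (simp add: signed_dist_def)
qed

lemma pointed_imp_eq_0:
  assumes "pointed C" and "w \<in> C" and "- w \<in> C"
  shows "w = 0"
proof -
  have "w \<in> uminus ` C"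
    using assms(3) by (metis image_eqI minus_minus)
  then show ?thesis
    using assms unfolding pointed_def by blast
qed

lemma pointed_neq_UNIV: "pointed (C :: (real ^ 'p) set) \<Longrightarrow> C \<noteq> UNIV"
  using pointed_imp_eq_0[of C 1] by auto

text \<open>A positive value would put a ball around 0 into \<open>C\<close>, and with it a nonzero
  vector and its negative.\<close>

lemma signed_dist_pointed_0:
  fixes C :: "(real ^ 'p) set"
  assumes "pointed C"
  shows "signed_dist C 0 = 0"
proof (rule ccontr)
  assume "signed_dist C 0 \<noteq> 0"
  define r where "r = infdist 0 (UNIV - C)"
  have "0 \<in> C" using assms unfolding pointed_def by blast
  then have "0 < r"
    using \<open>signed_dist C 0 \<noteq> 0\<close> infdist_nonneg[of 0 "UNIV - C"]
    by (simp add: signed_dist_mem r_def)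
  define w :: "real ^ 'p" where "w = (r / 2 / norm (1 :: real ^ 'p)) *\<^sub>R 1"
  have "ball 0 r \<subseteq> C"
    using le_infdist_compl_iff[OF pointed_neq_UNIV[OF assms], of r 0] by (simp add: r_def)
  moreover have "norm w = r / 2"
    using \<open>0 < r\<close> by (simp add: w_def)
  ultimately have "w \<in> C" "- w \<in> C"
    using \<open>0 < r\<close> by (auto simp: subset_iff)
  then have "w = 0"
    by (rule pointed_imp_eq_0[OF assms])
  with \<open>norm w = r / 2\<close> \<open>0 < r\<close> show False by simp
qed

subsection \<open>The signed distance to \<open>E\<^sup>\<epsilon>\<close>\<close>

lemma E_cone_add_nonneg:
  assumes "y \<in> E_cone x t k \<epsilon>" and "0 \<le> v"
  shows "y + v \<in> E_cone x t k \<epsilon>"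
proof -
  obtain c w where y: "y = (\<Sum>j\<in>{1..t}. c j *\<^sub>R (x j - \<epsilon> *\<^sub>R 1 - x k)) + w"
      "\<forall>j\<in>{1..t}. 0 \<le> c j" "0 \<le> w"
    using assms(1) unfolding E_cone_def by blast
  moreover have "0 \<le> w + v"
    using y(3) assms(2) by (simp add: less_eq_vec_def)
  ultimately show ?thesis
    unfolding E_cone_def
    by (intro CollectI exI[of _ c] exI[of _ "w + v"]) (simp add: add.assoc)
qed

lemma E_cone_generator:
  assumes "j \<in> {1..t}"
  shows "x j - \<epsilon> *\<^sub>R 1 - x k \<in> E_cone x t k \<epsilon>"
proof -
  have "(\<Sum>i\<in>{1..t}. (if i = j then 1 else 0) *\<^sub>R (x i - \<epsilon> *\<^sub>R 1 - x k)) = x j - \<epsilon> *\<^sub>R 1 - x k"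
    using assms by (simp add: if_distrib[of "\<lambda>c. c *\<^sub>R _"] cong: if_cong)
  then show ?thesis
    unfolding E_cone_def
    by (intro CollectI exI[of _ "\<lambda>i. if i = j then 1 else 0"] exI[of _ 0]) simp
qed

text \<open>All summands of \<open>y \<bullet> d\<close> are nonnegative, so the product vanishes
  only if all coefficients and \<open>v\<close> do. Opposite elements of the cone therefore both
  have product 0 with \<open>d\<close>.\<close>

lemma pointed_E_cone:
  fixes x :: "nat \<Rightarrow> real ^ 'p"
  assumes d: "\<And>i. 0 < d $ i"
    and gen: "\<And>j. j \<in> {1..t} \<Longrightarrow> 0 < (x j - \<epsilon> *\<^sub>R 1 - x k) \<bullet> d"
  shows "pointed (E_cone x t k \<epsilon>)"
proof -
  let ?a = "\<lambda>j. x j - \<epsilon> *\<^sub>R 1 - x k"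
  have pos: "0 \<le> y \<bullet> d \<and> (y \<bullet> d = 0 \<longrightarrow> y = 0)" if y_in: "y \<in> E_cone x t k \<epsilon>" for y
  proof -
    obtain c v where y: "y = (\<Sum>j\<in>{1..t}. c j *\<^sub>R ?a j) + v"
        "\<forall>j\<in>{1..t}. 0 \<le> c j" "0 \<le> v"
      using y_in unfolding E_cone_def by blast
    have yd: "y \<bullet> d = (\<Sum>j\<in>{1..t}. c j * (?a j \<bullet> d)) + v \<bullet> d"
      by (simp add: y(1) inner_add_left inner_sum_left)
    have "0 \<le> v \<bullet> d"
      using d y(3) by (intro inner_nonneg_vec) (simp_all add: less_eq_vec_def less_imp_le)
    have nonneg: "0 \<le> c j * (?a j \<bullet> d)" if "j \<in> {1..t}" for j
      using y(2) gen that by (simp add: less_imp_le)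
    then have "0 \<le> (\<Sum>j\<in>{1..t}. c j * (?a j \<bullet> d))"
      by (rule sum_nonneg)
    moreover have "y = 0" if "y \<bullet> d = 0"
    proof -
      have "v \<bullet> d = 0" and "(\<Sum>j\<in>{1..t}. c j * (?a j \<bullet> d)) = 0"
        using \<open>0 \<le> v \<bullet> d\<close> \<open>0 \<le> (\<Sum>j\<in>{1..t}. c j * (?a j \<bullet> d))\<close> that yd by linarith+
      from \<open>v \<bullet> d = 0\<close> have "v = 0"
        using inner_eq_0_pos_vec d y(3) by blast
      moreover have "\<forall>j\<in>{1..t}. c j * (?a j \<bullet> d) = 0"
        using \<open>(\<Sum>j\<in>{1..t}. c j * (?a j \<bullet> d)) = 0\<close> nonneg
        by (subst (asm) sum_nonneg_eq_0_iff) auto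
      then have "\<forall>j\<in>{1..t}. c j = 0"
        using gen by (metis less_irrefl mult_eq_0_iff)
      ultimately show ?thesis by (simp add: y(1))
    qed
    ultimately show ?thesis
      using yd \<open>0 \<le> v \<bullet> d\<close> by simp
  qed
  have "y = 0" if "y \<in> E_cone x t k \<epsilon>" "- y \<in> E_cone x t k \<epsilon>" for y
    using pos[OF that(1)] pos[OF that(2)] by simp
  moreover have "0 \<in> E_cone x t k \<epsilon>"
    using convex_cone_E_cone[of x t k \<epsilon>] by (simp add: convex_cone_iff)
  ultimately show ?thesis
    unfolding pointed_def by force
qed

lemma signed_dist_E_cone_pos:
  fixes x :: "nat \<Rightarrow> real ^ 'p"
  assumes "0 < \<epsilon>" and "E_cone x t k \<epsilon> \<noteq> UNIV" and "j \<in> {1..t}"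
  shows "0 < signed_dist (E_cone x t k \<epsilon>) (x j - x k)"
proof -
  have ball: "ball (x j - x k) \<epsilon> \<subseteq> E_cone x t k \<epsilon>"
  proof
    fix w assume w: "w \<in> ball (x j - x k) \<epsilon>"
    \<comment> \<open>Coordinates are bounded by the Euclidean norm, so \<open>w\<close> dominates
      the generator componentwise.\<close>
    have "\<bar>(x j - x k - w) $ i\<bar> \<le> \<epsilon>" for i
      using w component_le_norm_cart[of "x j - x k - w" i] by (simp add: dist_norm)
    then have "0 \<le> w - (x j - \<epsilon> *\<^sub>R 1 - x k)"
      by (simp add: less_eq_vec_def abs_le_iff algebra_simps)
    then show "w \<in> E_cone x t k \<epsilon>"
      using E_cone_add_nonneg[OF E_cone_generator[OF assms(3), of x \<epsilon> k]] by fastforce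
  qed
  then have "x j - x k \<in> E_cone x t k \<epsilon>"
    using assms(1) by auto
  then show ?thesis
    using ball le_infdist_compl_iff[OF assms(2), of \<epsilon>] assms(1)
    by (simp add: signed_dist_mem less_le_trans)
qed

lemma quasi_concave_translation:
  assumes "quasi_concave f"
  shows "quasi_concave (\<lambda>y. f (y - a))"
  unfolding quasi_concave_def
proof (intro allI ballI)
  fix y z and u :: real
  assume "u \<in> {0..1}"
  moreover have "u *\<^sub>R y + (1 - u) *\<^sub>R z - a = u *\<^sub>R (y - a) + (1 - u) *\<^sub>R (z - a)"
    by (simp add: algebra_simps)
  ultimately show "min (f (y - a)) (f (z - a)) \<le> f (u *\<^sub>R y + (1 - u) *\<^sub>R z - a)"
    using assms unfolding quasi_concave_def by metis
qed

lemma signed_dist_pointed_E_cone: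
  fixes x :: "nat \<Rightarrow> real ^ 'p"
  assumes "0 < \<epsilon>" and pt: "pointed (E_cone x t k \<epsilon>)"
  defines "\<theta> \<equiv> \<lambda>y. signed_dist (E_cone x t k \<epsilon>) (y - x k)"
  shows "mono \<theta>" and "quasi_concave \<theta>" and "\<And>j. j \<in> {1..t} \<Longrightarrow> \<theta> (x k) < \<theta> (x j)"
proof -
  note proper = pointed_neq_UNIV[OF pt]
  have cone: "convex (E_cone x t k \<epsilon>)" "E_cone x t k \<epsilon> \<noteq> {}"
    using convex_cone_E_cone[of x t k \<epsilon>] by (auto simp: convex_cone_def)
  have "mono (signed_dist (E_cone x t k \<epsilon>))"
    by (intro mono_signed_dist E_cone_add_nonneg cone proper)
  then show "mono \<theta>"
    by (auto simp: \<theta>_def less_eq_vec_def intro!: monoI elim!: monoD)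
  show "quasi_concave \<theta>"
    unfolding \<theta>_def by (intro quasi_concave_translation quasi_concave_signed_dist cone proper)
  show "\<theta> (x k) < \<theta> (x j)" if "j \<in> {1..t}" for j
    using signed_dist_E_cone_pos[OF assms(1) proper that] signed_dist_pointed_0[OF pt]
    by (simp add: \<theta>_def)
qed

section \<open>The two directions of the equivalence\<close>

lemma lp_value_eq_0_if_quasi_concave:
  fixes x :: "nat \<Rightarrow> real ^ 'p"
  assumes "1 \<le> t" and "mono \<theta>" and "quasi_concave \<theta>" and "\<forall>j\<in>{1..t}. \<theta> (x j) > \<theta> (x k)"
  shows "lp_value x t k = 0"
proof -
  have "\<exists>d\<ge>0. \<forall>y\<in>x ` {1..t}. 0 < (y - x k) \<bullet> d"
    by (rule positive_functional_of_quasi_concave[of _ \<theta>]) (use assms in auto)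
  then obtain d where "0 \<le> d" "\<And>j. j \<in> {1..t} \<Longrightarrow> 0 < (x j - x k) \<bullet> d"
    by blast
  then show ?thesis
    unfolding lp_value_eq_0_iff
    using positive_functional_perturbation[of "{1..t}" d "\<lambda>j. x j - x k"] by simp
qed

lemma ex_pointed_E_cone:
  fixes x :: "nat \<Rightarrow> real ^ 'p"
  assumes "lp_value x t k = 0"
  shows "\<exists>\<epsilon>>0. pointed (E_cone x t k \<epsilon>)"
proof -
  obtain d where d: "\<And>i. 0 < d $ i" "\<And>j. j \<in> {1..t} \<Longrightarrow> 0 < (x j - x k) \<bullet> d"
    using assms unfolding lp_value_eq_0_iff by blast
  \<comment> \<open>Shifting a generator by \<open>- \<epsilon> *\<^sub>R 1\<close> costs
    \<open>\<epsilon> * (1 \<bullet> d)\<close> in its product with \<open>d\<close>.\<close>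
  obtain \<epsilon> where \<epsilon>: "0 < \<epsilon>" "\<forall>j\<in>{1..t}. \<epsilon> * (1 \<bullet> d) < (x j - x k) \<bullet> d"
    using finite_small_multiple[of "{1..t}" "\<lambda>j. (x j - x k) \<bullet> d" "\<lambda>_. 1 \<bullet> d"] d(2) by blast
  have "0 < (x j - \<epsilon> *\<^sub>R 1 - x k) \<bullet> d" if "j \<in> {1..t}" for j
    using \<epsilon>(2) that by (fastforce simp: inner_diff_left)
  then show ?thesis
    using pointed_E_cone d(1) \<epsilon>(1) by blast
qed

theorem corollary3:
  fixes x :: "nat \<Rightarrow> real ^ 'p" and m t k :: nat
  assumes "inj_on x {1..m}"
    and "1 \<le> t" and "t < m"
    and "k \<in> {1..m} - {1..t}"
  shows "((\<exists>\<theta> :: real ^ 'p \<Rightarrow> real.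
            mono \<theta> \<and> quasi_concave \<theta> \<and> (\<forall>j\<in>{1..t}. \<theta> (x j) > \<theta> (x k)))
          \<longleftrightarrow> lp_value x t k = 0) \<and>
    (lp_value x t k = 0 \<longrightarrow>
      (\<exists>\<epsilon>>0. pointed (E_cone x t k \<epsilon>)) \<and>
      (\<forall>\<epsilon>>0. pointed (E_cone x t k \<epsilon>) \<longrightarrow>
        (let \<theta> = (\<lambda>y. signed_dist (E_cone x t k \<epsilon>) (y - x k)) in
          mono \<theta> \<and> quasi_concave \<theta> \<and> (\<forall>j\<in>{1..t}. \<theta> (x j) > \<theta> (x k)))))"
  \<comment> \<open>If the optimal value is 0, the signed distance to a pointed cone also witnesses
    the existence claim.\<close>
  by (metis assms(2) ex_pointed_E_cone lp_value_eq_0_if_quasi_concave signed_dist_pointed_E_cone)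

end
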